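(* Let $1\le\ell\le m$ and $\alpha=(\alpha_1,\dots,\alpha_\ell)$ with $1\le\alpha_1<\dots<\alpha_\ell\le m$. The dimension $k_\alpha$ of the Schubert code $C_\alpha(\ell,m)$ equals the determinant of the $\ell\times\ell$ matrix whose $(i,j)$-th entry is $\binom{\alpha_j-j+1}{i-j+1}$: $$k_\alpha=\det_{1\le i,j\le\ell}\left(\binom{\alpha_j-j+1}{i-j+1}\right).$$
   Context: Binomial coefficients $\binom{n}{k}$ are $0$ for $k<0$. $\mathbb{F}_q$ is a finite field, $V=\mathbb{F}_q^m$ with standard basis $e_1,\dots,e_m$, $A_j=\mathrm{span}(e_1,\dots,e_j)$. $G_{\ell,m}$ is the Grassmannian of $\ell$-dimensional subspaces of $V$, and $\Omega_\alpha=\{W\in G_{\ell,m}:\dim(W\cap A_{\alpha_i})\ge i,\ i=1,\dots,\ell\}$. The Schubert code $C_\alpha(\ell,m)$ is the linear code associated with the projective system of $\mathbb{F}_q$-rational points of $\Omega_\alpha$ under the Plücker embedding $W\mapsto[w_1\wedge\dots\wedge w_\ell]\in\mathbb{P}(\wedge^\ell V)$; its dimension $k_\alpha$ is the dimension of the linear span in $\wedge^\ell V$ of the Plücker images of these points. (Equivalently, $k_\alpha=|\{\beta\in\mathbb{Z}^\ell: 1\le\beta_1<\dots<\beta_\ell\le m,\ \beta_i\le\alpha_i \ \forall i\}|$.) *)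

theory Defs
  imports
    "HOL-Library.Function_Algebras"
    "Jordan_Normal_Form.Determinant"
begin

(* All vectors are functions into the field with pointwise operations: vectors of F_q^m are
   indexed by nat (and vanish outside {1..m}), vectors of the exterior power are indexed by
   sets of naturals, and codewords are indexed by the points of the projective system. *)

definition fscale :: "'a::field \<Rightarrow> ('i \<Rightarrow> 'a) \<Rightarrow> 'i \<Rightarrow> 'a" where
  "fscale c v = (\<lambda>i. c * v i)"

interpretation fvs: vector_space "fscale :: 'a::field \<Rightarrow> ('i \<Rightarrow> 'a) \<Rightarrow> 'i \<Rightarrow> 'a"
  by unfold_locales (auto simp: fscale_def fun_eq_iff algebra_simps)

definition Vsp :: "nat \<Rightarrow> (nat \<Rightarrow> 'a::field) set" where
  "Vsp m = {v. \<forall>i. i \<notin> {1..m} \<longrightarrow> v i = 0}"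

definition std_basis :: "nat \<Rightarrow> nat \<Rightarrow> 'a::field" where
  "std_basis j = (\<lambda>i. if i = j then 1 else 0)"

definition flag :: "nat \<Rightarrow> (nat \<Rightarrow> 'a::field) set" where
  "flag j = fvs.span (std_basis ` {1..j})"

definition grassmannian :: "nat \<Rightarrow> nat \<Rightarrow> (nat \<Rightarrow> 'a::field) set set" where
  "grassmannian l m = {W. fvs.subspace W \<and> W \<subseteq> Vsp m \<and> fvs.dim W = l}"

definition schubert_variety ::
    "nat \<Rightarrow> nat \<Rightarrow> (nat \<Rightarrow> nat) \<Rightarrow> (nat \<Rightarrow> 'a::field) set set" where
  "schubert_variety l m \<alpha> =
     {W \<in> grassmannian l m. \<forall>i\<in>{1..l}. i \<le> fvs.dim (W \<inter> flag (\<alpha> i))}"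

(* The exterior power of order l of F_q^m has the basis e_I = e_{i_1} ^ ... ^ e_{i_l}, where
   I = {i_1 < ... < i_l} runs through the l-subsets of {1..m}. The coefficient of
   w_1 ^ ... ^ w_l at e_I is the minor of the matrix with rows w_1, ..., w_l in columns I. *)

definition wedge :: "nat \<Rightarrow> nat \<Rightarrow> (nat \<Rightarrow> 'a::field) list \<Rightarrow> nat set \<Rightarrow> 'a" where
  "wedge l m ws = (\<lambda>I. if I \<subseteq> {1..m} \<and> card I = l
     then det (mat l l (\<lambda>(r, s). (ws ! r) (sorted_list_of_set I ! s))) else 0)"

definition ordered_basis ::
    "(nat \<Rightarrow> 'a::field) set \<Rightarrow> (nat \<Rightarrow> 'a) list \<Rightarrow> bool" where
  "ordered_basis W ws \<longleftrightarrow>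
     distinct ws \<and> fvs.independent (set ws) \<and> fvs.span (set ws) = W"

(* The point [w_1 ^ ... ^ w_l] of projective space, as a one-dimensional subspace. Any two
   ordered bases of W have proportional wedge products, so the span is that line. *)

definition plucker ::
    "nat \<Rightarrow> nat \<Rightarrow> (nat \<Rightarrow> 'a::field) set \<Rightarrow> (nat set \<Rightarrow> 'a) set" where
  "plucker l m W = fvs.span {wedge l m ws |ws. ordered_basis W ws}"

definition schubert_system ::
    "nat \<Rightarrow> nat \<Rightarrow> (nat \<Rightarrow> nat) \<Rightarrow> (nat set \<Rightarrow> 'a::field) set set" where
  "schubert_system l m \<alpha> = plucker l m ` schubert_variety l m \<alpha>"

(* A choice of a nonzero vector on each line of a projective system. *)

definition representatives ::
    "('i \<Rightarrow> 'a::field) set set \<Rightarrow> (('i \<Rightarrow> 'a) set \<Rightarrow> 'i \<Rightarrow> 'a) \<Rightarrow> bool" where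
  "representatives X \<rho> \<longleftrightarrow> (\<forall>P\<in>X. \<rho> P \<in> P \<and> \<rho> P \<noteq> 0)"

(* The code of a projective system X consists of the evaluations (f (\<rho> P))_{P in X} of all
   linear functionals f; different choices of \<rho> give monomially equivalent codes.
   The functionals are taken on the whole function space: their restrictions to a
   subspace are all functionals on that subspace. Codewords vanish outside X. *)

definition linear_code ::
    "('i \<Rightarrow> 'a::field) set set \<Rightarrow> (('i \<Rightarrow> 'a) set \<Rightarrow> 'i \<Rightarrow> 'a) \<Rightarrow> (('i \<Rightarrow> 'a) set \<Rightarrow> 'a) set"
  where
  "linear_code X \<rho> =
     {(\<lambda>P. if P \<in> X then f (\<rho> P) else 0) |f. Vector_Spaces.linear fscale (*) f}"

definition schubert_code ::
    "nat \<Rightarrow> nat \<Rightarrow> (nat \<Rightarrow> nat) \<Rightarrow> ((nat set \<Rightarrow> 'a::field) set \<Rightarrow> nat set \<Rightarrow> 'a)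
      \<Rightarrow> ((nat set \<Rightarrow> 'a) set \<Rightarrow> 'a) set" where
  "schubert_code l m \<alpha> \<rho> = linear_code (schubert_system l m \<alpha>) \<rho>"

(* Binomial coefficients vanish for a negative lower argument. *)

definition zbinom :: "nat \<Rightarrow> int \<Rightarrow> int" where
  "zbinom n k = (if k < 0 then 0 else int (n choose nat k))"

interpretation fvs_field: vector_space_pair "fscale :: 'a::field \<Rightarrow> ('i \<Rightarrow> 'a) \<Rightarrow> 'i \<Rightarrow> 'a" "(*)"
  by unfold_locales (auto simp: algebra_simps)

(* The dimension of the code is the dimension of the span of the representatives, that is, of
   the points of X. *)

lemma dim_linear_code:
  fixes X :: "('i \<Rightarrow> 'a::field) set set"
  assumes fin: "finite X"
  shows "fvs.dim (linear_code X \<rho>) = fvs.dim (\<rho> ` X)"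
proof -
  obtain B where B: "B \<subseteq> \<rho> ` X" "fvs.independent B" "\<rho> ` X \<subseteq> fvs.span B" "card B = fvs.dim (\<rho> ` X)"
    using fvs.basis_exists by blast
  have finB: "finite B" using B(1) fin finite_surj by auto
  define \<delta> where "\<delta> b = fvs_field.construct B (\<lambda>b'. if b' = b then 1 else (0::'a))" for b
  define ev where "ev f = (\<lambda>P. if P \<in> X then f (\<rho> P) else (0::'a))" for f :: "('i \<Rightarrow> 'a) \<Rightarrow> 'a"
  have lin: "Vector_Spaces.linear fscale (*) (\<delta> b)" for b
    unfolding \<delta>_def by (rule fvs_field.linear_construct[OF B(2)])
  have dB: "\<delta> b b' = (if b' = b then 1 else 0)" if "b' \<in> B" for b b'
    unfolding \<delta>_def using fvs_field.construct_basis[OF B(2) that] by auto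
  have code: "linear_code X \<rho> = {ev f |f. Vector_Spaces.linear fscale (*) f}"
    by (auto simp: linear_code_def ev_def)
  define p where "p b = (SOME P. P \<in> X \<and> \<rho> P = b)" for b
  have p: "p b \<in> X" "\<rho> (p b) = b" if "b \<in> B" for b
  proof -
    have "\<exists>P. P \<in> X \<and> \<rho> P = b" using that B(1) by auto
    from someI_ex[OF this] show "p b \<in> X" "\<rho> (p b) = b" by (auto simp: p_def)
  qed
  have evp: "ev (\<delta> b) (p b') = (if b' = b then 1 else 0)" if "b' \<in> B" for b b'
    using that by (simp add: ev_def p dB)
  have inj: "inj_on (\<lambda>b. ev (\<delta> b)) B"
    by (rule inj_onI) (metis evp zero_neq_one)
  let ?C = "(\<lambda>b. ev (\<delta> b)) ` B"
  have sumapp: "(\<Sum>x\<in>A. g x) P = (\<Sum>x\<in>A. g x P)" for A :: "'c set" and g :: "'c \<Rightarrow> 'd \<Rightarrow> 'a" and P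
    by (induction A rule: infinite_finite_induct) auto
  have ind: "fvs.independent ?C"
  proof (rule fvs.independent_if_scalars_zero)
    show "finite ?C" using finB by simp
    fix g x assume 0: "(\<Sum>x\<in>?C. fscale (g x) x) = 0" and "x \<in> ?C"
    then obtain b where b: "b \<in> B" "x = ev (\<delta> b)" by auto
    have "0 = (\<Sum>b\<in>B. fscale (g (ev (\<delta> b))) (ev (\<delta> b))) (p b)"
      using 0 by (simp add: sum.reindex[OF inj])
    also have "\<dots> = (\<Sum>b'\<in>B. if b = b' then g (ev (\<delta> b')) else 0)"
      unfolding sumapp fscale_def using b by (auto simp: evp intro!: sum.cong)
    also have "\<dots> = g x" using b finB by simp
    finally show "g x = 0" by simp
  qed
  have "linear_code X \<rho> \<subseteq> fvs.span ?C"
  proof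
    fix c assume "c \<in> linear_code X \<rho>"
    then obtain f where f: "Vector_Spaces.linear fscale (*) f" "c = ev f" by (auto simp: code)
    have "f v = (\<Sum>b\<in>B. f b * \<delta> b v)" if "v \<in> fvs.span B" for v
    proof (rule fvs_field.linear_eq_on[OF f(1) _ that])
      show "Vector_Spaces.linear fscale (*) (\<lambda>v. \<Sum>b\<in>B. f b * \<delta> b v)"
        by (intro fvs_field.linear_compose_sum ballI fvs_field.linear_compose_scale_right lin)
      show "f b' = (\<Sum>b\<in>B. f b * \<delta> b b')" if "b' \<in> B" for b'
        using that finB by (simp add: dB if_distrib[of "(*) _"] cong: if_cong)
    qed
    then have "c = (\<Sum>b\<in>B. fscale (f b) (ev (\<delta> b)))"
      using B(3) by (auto simp: f(2) ev_def fun_eq_iff sumapp fscale_def image_subset_iff)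
    moreover have "(\<Sum>b\<in>B. fscale (f b) (ev (\<delta> b))) \<in> fvs.span ?C"
      by (intro fvs.span_sum fvs.span_scale fvs.span_base imageI)
    ultimately show "c \<in> fvs.span ?C" by simp
  qed
  moreover have "?C \<subseteq> linear_code X \<rho>" using lin by (auto simp: code)
  ultimately have "fvs.dim (linear_code X \<rho>) = card ?C"
    using ind fvs.dim_unique by blast
  then show ?thesis using card_image[OF inj] B(4) by simp
qed

end

theory Submission
  imports Defs
begin

text \<open>
  The code has the dimension of the span of the Pluecker points. If \<open>W\<close> lies in \<open>\<Omega>\<^sub>\<alpha>\<close> and the
  minor of a basis of \<open>W\<close> in the columns \<open>I\<close> is nonzero, no nonzero vector of \<open>W\<close> vanishes on \<open>I\<close>;
  a dimension count in \<open>W \<inter> A\<^bsub>\<alpha>\<^sub>i\<^esub>\<close> then forces \<open>I \<le> \<alpha>\<close> componentwise. Conversely the coordinate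
  subspace of such an \<open>I\<close> lies in \<open>\<Omega>\<^sub>\<alpha>\<close> and has the Pluecker point \<open>e\<^sub>I\<close>. So the dimension is the
  number \<open>N\<^sub>\<ell>\<close> of index sets \<open>I \<le> \<alpha>\<close>. The matrix is lower Hessenberg with superdiagonal 1, so that
  its leading principal minors satisfy the recursion
  \<open>D\<^sub>n\<^sub>+\<^sub>1 = (\<Sum>k\<le>n. (-1)\<^bsup>n-k\<^esup> (\<alpha>\<^sub>k\<^sub>+\<^sub>1 - k choose n - k + 1) D\<^sub>k)\<close>. The counts \<open>N\<^sub>k\<close> of
  \<open>k\<close>-subsets bounded by \<open>(\<alpha>\<^sub>1, \<dots>, \<alpha>\<^sub>k)\<close> satisfy it too: splitting the
  pairs counted by the product of \<open>N\<^sub>k\<close> and the binomial coefficient makes the alternating sum telescope.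
\<close>

section \<open>Hessenberg determinants\<close>

text \<open>Expand along the last row. Deleting column \<open>k\<close> leaves a block lower
  triangular matrix whose diagonal blocks are the leading \<open>k\<close> by \<open>k\<close> block
  and a lower unitriangular one.\<close>

lemma det_hessenberg_rec:
  fixes f :: "nat \<Rightarrow> nat \<Rightarrow> 'a::idom"
  assumes one: "\<And>r. f r (Suc r) = 1" and zero: "\<And>r s. Suc r < s \<Longrightarrow> f r s = 0"
  shows "det (mat (Suc n) (Suc n) (\<lambda>(r, s). f r s)) =
    (\<Sum>k<Suc n. (-1) ^ (n - k) * f n k * det (mat k k (\<lambda>(r, s). f r s)))"
proof -
  let ?A = "\<lambda>k. mat k k (\<lambda>(r, s). f r s)"
  have minor: "det (mat_delete (?A (Suc n)) n k) = det (?A k)" if k: "k \<le> n" for k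
  proof -
    define C where "C = mat (n - k) k (\<lambda>(r, s). f (r + k) s)"
    \<comment> \<open>Past the deleted column the columns shift by one, so the superdiagonal entries
      1 become the diagonal of \<open>L\<close>.\<close>
    define L where "L = mat (n - k) (n - k) (\<lambda>(r, s). f (r + k) (Suc (s + k)))"
    have "mat_delete (?A (Suc n)) n k = four_block_mat (?A k) (0\<^sub>m k (n - k)) C L"
      using k by (intro eq_matI)
        (auto simp: mat_delete_def four_block_mat_def Let_def C_def L_def intro!: zero)
    then have "det (mat_delete (?A (Suc n)) n k) = det (?A k) * det L"
      by (simp add: det_four_block_mat_upper_right_zero[of _ k _ "n - k"] C_def L_def)
    also have "det L = prod_list (diag_mat L)"
      by (rule det_lower_triangular[of "n - k"]) (auto simp: L_def intro!: zero)
    also have "diag_mat L = replicate (n - k) 1"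
      by (intro nth_equalityI) (auto simp: diag_mat_def L_def one)
    finally show ?thesis by simp
  qed
  have "det (?A (Suc n)) = (\<Sum>k<Suc n. ?A (Suc n) $$ (n, k) * cofactor (?A (Suc n)) n k)"
    by (rule laplace_expansion_row) auto
  also have "\<dots> = (\<Sum>k<Suc n. (-1) ^ (n - k) * f n k * det (?A k))"
  proof (rule sum.cong[OF refl])
    fix k assume k: "k \<in> {..<Suc n}"
    have "(-1) ^ (n + k) = ((-1) ^ (n - k) :: 'a)"
      using k by (metis minus_one_power_iff even_diff_nat lessThan_iff less_Suc_eq_le not_less)
    then show "?A (Suc n) $$ (n, k) * cofactor (?A (Suc n)) n k = (-1) ^ (n - k) * f n k * det (?A k)"
      using k by (simp add: cofactor_def minor)
  qed
  finally show ?thesis .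
qed

section \<open>Bounded index sets\<close>

lemma strict_mono_on_ge_index:
  fixes \<alpha> :: "nat \<Rightarrow> nat"
  assumes mono: "strict_mono_on {1..l} \<alpha>" and bound: "\<alpha> ` {1..l} \<subseteq> {1..m}" and "1 \<le> i" "i \<le> l"
  shows "i \<le> \<alpha> i"
  using assms(3,4)
proof (induction i rule: dec_induct)
  case base
  with bound show ?case by (simp add: image_subset_iff)
next
  case (step i)
  then have "\<alpha> i < \<alpha> (Suc i)" by (intro strict_mono_onD[OF mono]) auto
  with step show ?case by simp
qed

text \<open>The cardinality condition says that the \<open>i\<close>-th smallest element of
  \<open>I\<close> is at most \<open>\<alpha> i\<close>; it mirrors the dimension condition on the
  flag and avoids sorting. The ambient bound \<open>n\<close> is kept separate from
  \<open>\<alpha>\<close> so that one can induct on it.\<close>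

definition schubert_index :: "(nat \<Rightarrow> nat) \<Rightarrow> nat \<Rightarrow> nat \<Rightarrow> nat set set" where
  "schubert_index \<alpha> l n = {I. I \<subseteq> {1..n} \<and> card I = l \<and> (\<forall>i\<in>{1..l}. i \<le> card (I \<inter> {1..\<alpha> i}))}"

lemma finite_schubert_index [simp]: "finite (schubert_index \<alpha> l n)"
  by (rule finite_subset[of _ "Pow {1..n}"]) (auto simp: schubert_index_def)

lemma schubert_index_0 [simp]: "schubert_index \<alpha> 0 n = {{}}"
  by (auto simp: schubert_index_def dest: finite_subset)

lemma schubert_index_eq_empty: "n < l \<Longrightarrow> schubert_index \<alpha> l n = {}"
  by (auto simp: schubert_index_def dest!: card_mono[rotated])

text \<open>The condition at the last index already forces all of \<open>I\<close> into
  \<open>{1..\<alpha> (Suc k)}\<close>.\<close>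

lemma schubert_index_large:
  assumes "\<alpha> (Suc k) \<le> n" "\<alpha> (Suc k) \<le> m"
  shows "schubert_index \<alpha> (Suc k) n = schubert_index \<alpha> (Suc k) m"
proof -
  have sub: "I \<subseteq> {1..\<alpha> (Suc k)}" if "I \<in> schubert_index \<alpha> (Suc k) p" for I p
  proof -
    have "finite I" "card I = Suc k" "Suc k \<le> card (I \<inter> {1..\<alpha> (Suc k)})"
      using that by (auto simp: schubert_index_def dest: finite_subset)
    then have "I \<inter> {1..\<alpha> (Suc k)} = I" by (intro card_seteq) auto
    then show ?thesis by auto
  qed
  have "schubert_index \<alpha> (Suc k) p \<subseteq> schubert_index \<alpha> (Suc k) q" if "\<alpha> (Suc k) \<le> q" for p q
  proof
    fix I assume I: "I \<in> schubert_index \<alpha> (Suc k) p"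
    then have "I \<subseteq> {1..\<alpha> (Suc k)}" by (rule sub)
    then have "I \<subseteq> {1..q}" using that by auto
    with I show "I \<in> schubert_index \<alpha> (Suc k) q" by (simp add: schubert_index_def)
  qed
  with assms show ?thesis by blast
qed

text \<open>Split according to whether \<open>Suc n\<close> belongs to \<open>I\<close>; if so, it
  is the largest element, and removing it leaves the first \<open>k\<close> conditions
  intact.\<close>

lemma card_schubert_index_Suc:
  "card (schubert_index \<alpha> (Suc k) (Suc n)) =
    card (schubert_index \<alpha> (Suc k) n) + (if Suc n \<le> \<alpha> (Suc k) then card (schubert_index \<alpha> k n) else 0)"
proof -
  let ?S = "schubert_index \<alpha> (Suc k) (Suc n)"
  let ?T = "if Suc n \<le> \<alpha> (Suc k) then schubert_index \<alpha> k n else {}"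
  have old: "{I \<in> ?S. Suc n \<notin> I} = schubert_index \<alpha> (Suc k) n"
    by (auto simp: schubert_index_def atLeastAtMostSuc_conv)
  have ins: "insert (Suc n) J \<in> ?S \<longleftrightarrow> J \<in> ?T" if J: "J \<subseteq> {1..n}" for J
  proof -
    have fin: "finite J" and notin: "Suc n \<notin> J" using J finite_subset by auto
    have sub: "J \<inter> {Suc 0..a} = J" if "Suc n \<le> a" for a using J that by auto
    have ge: "insert (Suc n) J \<inter> {Suc 0..a} = insert (Suc n) J" if "Suc n \<le> a" for a
      using J that by auto
    have lt: "insert (Suc n) J \<inter> {Suc 0..a} = J \<inter> {Suc 0..a}" if "\<not> Suc n \<le> a" for a
      using that by auto
    \<comment> \<open>If \<open>\<alpha> i\<close> reaches \<open>Suc n\<close>, then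
      \<open>{1..\<alpha> i}\<close> contains all of \<open>J\<close> and both sides hold because
      \<open>i \<le> k\<close>; otherwise the new element is not seen.\<close>
    have cond: "i \<le> card (insert (Suc n) J \<inter> {1..\<alpha> i}) \<longleftrightarrow> i \<le> card (J \<inter> {1..\<alpha> i})"
      if "i \<in> {1..k}" "card J = k" for i
      using that fin notin by (cases "Suc n \<le> \<alpha> i") (simp_all add: sub ge lt)
    have last: "Suc k \<le> card (insert (Suc n) J \<inter> {1..\<alpha> (Suc k)}) \<longleftrightarrow> Suc n \<le> \<alpha> (Suc k)"
      if "card J = k"
    proof (cases "Suc n \<le> \<alpha> (Suc k)")
      case True
      then show ?thesis using fin notin that by (simp add: ge del: Int_insert_left_if1)
    next
      case False
      have "card (J \<inter> {1..\<alpha> (Suc k)}) \<le> card J" by (intro card_mono fin) auto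
      with False that show ?thesis by (simp add: lt)
    qed
    have "insert (Suc n) J \<in> ?S \<longleftrightarrow> card J = k \<and> (\<forall>i\<in>{1..k}. i \<le> card (insert (Suc n) J \<inter> {1..\<alpha> i}))
        \<and> Suc k \<le> card (insert (Suc n) J \<inter> {1..\<alpha> (Suc k)})"
      using J fin notin by (auto simp: schubert_index_def atLeastAtMostSuc_conv)
    also have "\<dots> \<longleftrightarrow> card J = k \<and> (\<forall>i\<in>{1..k}. i \<le> card (J \<inter> {1..\<alpha> i})) \<and> Suc n \<le> \<alpha> (Suc k)"
      using cond last by blast
    also have "\<dots> \<longleftrightarrow> J \<in> ?T"
      using J by (auto simp: schubert_index_def)
    finally show ?thesis .
  qed
  have T: "J \<subseteq> {1..n}" if "J \<in> ?T" for J
    using that by (auto simp: schubert_index_def split: if_splits)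
  have new: "{I \<in> ?S. Suc n \<in> I} = insert (Suc n) ` ?T"
  proof (intro equalityI subsetI)
    fix I assume I: "I \<in> {I \<in> ?S. Suc n \<in> I}"
    then have "I - {Suc n} \<subseteq> {1..n}" by (auto simp: schubert_index_def atLeastAtMostSuc_conv)
    from ins[OF this] I have "I - {Suc n} \<in> ?T" by (auto simp: insert_absorb)
    then show "I \<in> insert (Suc n) ` ?T"
      using I by (intro image_eqI[of _ _ "I - {Suc n}"]) (auto simp: insert_absorb)
  next
    fix I assume "I \<in> insert (Suc n) ` ?T"
    then obtain J where "J \<in> ?T" "I = insert (Suc n) J" by blast
    with T ins show "I \<in> {I \<in> ?S. Suc n \<in> I}" by blast
  qed
  have inj: "inj_on (insert (Suc n)) ?T"
  proof (rule inj_onI)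
    fix J K assume "J \<in> ?T" "K \<in> ?T" and eq: "insert (Suc n) J = insert (Suc n) K"
    with T have "J \<subseteq> {1..n}" "K \<subseteq> {1..n}" by blast+
    then have "Suc n \<notin> J" "Suc n \<notin> K" by auto
    with eq show "J = K" by (metis insert_ident)
  qed
  have "?S = {I \<in> ?S. Suc n \<notin> I} \<union> {I \<in> ?S. Suc n \<in> I}" by blast
  then have "card ?S = card {I \<in> ?S. Suc n \<notin> I} + card {I \<in> ?S. Suc n \<in> I}"
    by (subst card_Un_disjoint[symmetric]) auto
  then show ?thesis unfolding old new card_image[OF inj] by simp
qed

text \<open>As \<open>Suc n choose Suc r\<close> is the sum of \<open>x choose r\<close> over
  \<open>x \<le> n\<close>, the left side runs over pairs \<open>(x, y)\<close>. Those with
  \<open>y \<le> x\<close> give the first sum, those with \<open>x < y\<close> the second.\<close>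

lemma sum_by_parts_binomial:
  fixes g :: "nat \<Rightarrow> nat"
  shows "(\<Sum>y\<le>n. g y) * (Suc n choose Suc r) =
    (\<Sum>x\<le>n. (\<Sum>y\<le>x. g y) * (x choose r)) + (\<Sum>y\<le>n. g y * (y choose Suc r))"
  by (induction n) (simp_all add: algebra_simps)

text \<open>
  In terms of the weakly increasing sequence \<open>\<lambda>\<^sub>i = \<beta>\<^sub>i - i\<close> attached to \<open>I = {\<beta>\<^sub>1 < \<dots> < \<beta>\<^sub>k}\<close>,
  this counts the index sets with \<open>\<lambda>\<^sub>k = y\<close>.
\<close>
fun top_count :: "(nat \<Rightarrow> nat) \<Rightarrow> nat \<Rightarrow> nat \<Rightarrow> nat" where
  "top_count \<alpha> 0 y = (if y = 0 then 1 else 0)"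
| "top_count \<alpha> (Suc k) y = (if Suc (y + k) \<le> \<alpha> (Suc k) then card (schubert_index \<alpha> k (y + k)) else 0)"

text \<open>Lowering the ambient bound one step at a time splits off the sets with the current
  largest element. For \<open>k = 0\<close> the empty set is recorded at
  \<open>y = 0\<close>.\<close>

lemma card_schubert_index_eq_sum:
  "card (schubert_index \<alpha> k (x + k)) = (\<Sum>y\<le>x. top_count \<alpha> k y)"
proof (cases k)
  case 0
  then show ?thesis by simp
next
  case (Suc j)
  have "card (schubert_index \<alpha> (Suc j) (x + Suc j)) = (\<Sum>y\<le>x. top_count \<alpha> (Suc j) y)"
    by (induction x) (simp_all add: card_schubert_index_Suc schubert_index_eq_empty)
  with Suc show ?thesis by simp
qed

text \<open>
  Counting pairs \<open>\<lambda>\<^sub>1 \<le> \<dots> \<le> \<lambda>\<^sub>k\<close>, \<open>\<mu>\<^sub>0 > \<dots> > \<mu>\<^sub>r\<close> with \<open>\<mu>\<^sub>0 \<le> \<alpha>\<^sub>k\<^sub>+\<^sub>1 - (k + 1)\<close>, according to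
  whether \<open>\<lambda>\<^sub>k \<le> \<mu>\<^sub>0\<close> or \<open>\<lambda>\<^sub>k > \<mu>\<^sub>0\<close>.
\<close>
lemma card_schubert_index_times_binomial:
  assumes mono: "strict_mono_on {1..l} \<alpha>" and bound: "\<alpha> ` {1..l} \<subseteq> {1..m}" and k: "k < l"
  shows "card (schubert_index \<alpha> k m) * ((\<alpha> (Suc k) - k) choose Suc r) =
    (\<Sum>y\<le>m. top_count \<alpha> (Suc k) y * (y choose r)) + (\<Sum>y\<le>m. top_count \<alpha> k y * (y choose Suc r))"
proof -
  \<comment> \<open>The largest value allowed for the top part of the shifted sequence of length
    \<open>k + 1\<close>; the subtraction does not truncate since
    \<open>Suc k \<le> \<alpha> (Suc k)\<close>.\<close>
  define n where "n = \<alpha> (Suc k) - Suc k"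
  have \<alpha>: "\<alpha> (Suc k) = n + Suc k" using strict_mono_on_ge_index[OF mono bound, of "Suc k"] k by (simp add: n_def)
  have "\<alpha> (Suc k) \<le> m" using bound k by (simp add: image_subset_iff)
  then have nm: "n \<le> m" using \<alpha> by simp
  have card_eq: "card (schubert_index \<alpha> k m) = card (schubert_index \<alpha> k (n + k))"
  proof (cases k)
    case (Suc j)
    have "\<alpha> (Suc j) < \<alpha> (Suc k)" using Suc k by (intro strict_mono_onD[OF mono]) auto
    with \<alpha> \<open>\<alpha> (Suc k) \<le> m\<close> Suc show ?thesis
      by (intro arg_cong[of _ _ card]) (auto intro!: schubert_index_large)
  qed simp
  have vanish: "top_count \<alpha> k y = 0" if "n < y" for y
  proof (cases k)
    case (Suc j)
    have "\<alpha> (Suc j) < \<alpha> (Suc k)" using Suc k by (intro strict_mono_onD[OF mono]) auto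
    with \<alpha> Suc that show ?thesis by simp
  qed (use that in simp)
  \<comment> \<open>For \<open>x \<le> n\<close> the inner sum is
    \<open>top_count \<alpha> (Suc k) x\<close>, and beyond \<open>n\<close> that count
    vanishes.\<close>
  have "(\<Sum>x\<le>n. (\<Sum>y\<le>x. top_count \<alpha> k y) * (x choose r)) = (\<Sum>y\<le>m. top_count \<alpha> (Suc k) y * (y choose r))"
    using nm by (intro sum.mono_neutral_cong_left)
      (auto simp: \<alpha> card_schubert_index_eq_sum[symmetric])
  moreover have "(\<Sum>y\<le>n. top_count \<alpha> k y * (y choose Suc r)) = (\<Sum>y\<le>m. top_count \<alpha> k y * (y choose Suc r))"
    using nm by (intro sum.mono_neutral_left) (auto simp: vanish)
  moreover have "\<alpha> (Suc k) - k = Suc n" by (simp add: \<alpha>)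
  ultimately show ?thesis
    using sum_by_parts_binomial[of "top_count \<alpha> k" n r]
    by (simp only: card_eq card_schubert_index_eq_sum)
qed

lemma card_schubert_index_rec:
  assumes mono: "strict_mono_on {1..l} \<alpha>" and bound: "\<alpha> ` {1..l} \<subseteq> {1..m}" and n: "Suc n \<le> l"
  shows "int (card (schubert_index \<alpha> (Suc n) m)) =
    (\<Sum>k<Suc n. (-1) ^ (n - k) * int ((\<alpha> (Suc k) - k) choose Suc (n - k)) * int (card (schubert_index \<alpha> k m)))"
proof -
  \<comment> \<open>\<open>F k r\<close> counts index sets of size \<open>k\<close> paired with an
    \<open>r\<close>-subset of the numbers below their top part. Each product in the recursion is
    the sum of two such counts, one of which cancels against the neighbouring
    \<open>k\<close>.\<close>
  define F where "F k r = int (\<Sum>y\<le>m. top_count \<alpha> k y * (y choose r))" for k r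
  define T where "T k = (-1) ^ (Suc n - k) * F k (Suc n - k)" for k
  have "(-1) ^ (n - k) * int ((\<alpha> (Suc k) - k) choose Suc (n - k)) * int (card (schubert_index \<alpha> k m))
      = T (Suc k) - T k" if "k < Suc n" for k
  proof -
    let ?c = "int (card (schubert_index \<alpha> k m))" and ?b = "int ((\<alpha> (Suc k) - k) choose Suc (n - k))"
    have "?c * ?b = F (Suc k) (n - k) + F k (Suc (n - k))"
      using card_schubert_index_times_binomial[OF mono bound, of k "n - k"] that n
      unfolding F_def by (simp only: of_nat_add[symmetric] of_nat_mult[symmetric])
    then have "(-1) ^ (n - k) * ?b * ?c = (-1) ^ (n - k) * (F (Suc k) (n - k) + F k (Suc (n - k)))"
      by (metis mult.assoc mult.commute)
    moreover have "Suc n - k = Suc (n - k)" using that by simp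
    ultimately show ?thesis by (simp add: T_def algebra_simps)
  qed
  then have "(\<Sum>k<Suc n. (-1) ^ (n - k) * int ((\<alpha> (Suc k) - k) choose Suc (n - k)) * int (card (schubert_index \<alpha> k m)))
      = (\<Sum>k<Suc n. T (Suc k) - T k)"
    by (intro sum.cong) auto
  also have "\<dots> = T (Suc n) - T 0" by (rule sum_lessThan_telescope)
  \<comment> \<open>Only \<open>y = 0\<close> contributes to \<open>F 0\<close>, and
    \<open>0 choose Suc n\<close> is zero.\<close>
  also have "T 0 = 0"
    unfolding T_def F_def by (auto intro!: sum.neutral)
  \<comment> \<open>Here \<open>r = 0\<close>, so the binomial weights are all 1.\<close>
  also have "T (Suc n) = int (card (schubert_index \<alpha> (Suc n) (m + Suc n)))"
    by (simp add: T_def F_def card_schubert_index_eq_sum del: top_count.simps add_Suc_right)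
  also have "schubert_index \<alpha> (Suc n) (m + Suc n) = schubert_index \<alpha> (Suc n) m"
  proof -
    have "\<alpha> (Suc n) \<le> m" using bound n by (simp add: image_subset_iff)
    then show ?thesis by (intro schubert_index_large) auto
  qed
  finally show ?thesis by simp
qed

lemma card_schubert_index_eq_det:
  assumes mono: "strict_mono_on {1..l} \<alpha>" and bound: "\<alpha> ` {1..l} \<subseteq> {1..m}" and "n \<le> l"
  shows "int (card (schubert_index \<alpha> n m)) =
    det (mat n n (\<lambda>(r, s). let i = r + 1; j = s + 1 in zbinom (\<alpha> j - j + 1) (int i - int j + 1)))"
proof -
  define f where "f r s = (if s \<le> Suc r then int ((\<alpha> (Suc s) - s) choose (Suc r - s)) else 0)" for r s
  \<comment> \<open>Matrix positions start at 0, so \<open>s = j - 1\<close>. The bound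
    \<open>j \<le> \<alpha> j\<close> makes the natural-number expression
    \<open>\<alpha> j - j + 1\<close> equal to \<open>\<alpha> j - s\<close>.\<close>
  have entry: "(let i = r + 1; j = s + 1 in zbinom (\<alpha> j - j + 1) (int i - int j + 1)) = f r s" if "s < l" for r s
  proof -
    have "\<alpha> (Suc s) - Suc s + 1 = \<alpha> (Suc s) - s" using strict_mono_on_ge_index[OF mono bound, of "Suc s"] that by simp
    moreover have "nat (int (Suc r) - int (Suc s) + 1) = Suc r - s" by simp
    ultimately show ?thesis by (auto simp: zbinom_def f_def Let_def)
  qed
  have "int (card (schubert_index \<alpha> n m)) = det (mat n n (\<lambda>(r, s). f r s))" if "n \<le> l" for n
    using that
  proof (induction n rule: less_induct)
    case (less n)
    show ?case
    proof (cases n)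
      case (Suc p)
      have "det (mat n n (\<lambda>(r, s). f r s)) =
          (\<Sum>k<Suc p. (-1) ^ (p - k) * f p k * det (mat k k (\<lambda>(r, s). f r s)))"
        unfolding Suc by (rule det_hessenberg_rec) (auto simp: f_def)
      also have "\<dots> = (\<Sum>k<Suc p. (-1) ^ (p - k) * int ((\<alpha> (Suc k) - k) choose Suc (p - k)) * int (card (schubert_index \<alpha> k m)))"
        using less Suc by (intro sum.cong) (auto simp: f_def Suc_diff_le)
      also have "\<dots> = int (card (schubert_index \<alpha> n m))"
        unfolding Suc using less.prems Suc by (intro card_schubert_index_rec[OF mono bound, symmetric]) simp
      finally show ?thesis by simp
    qed simp
  qed
  moreover have "mat n n (\<lambda>(r, s). let i = r + 1; j = s + 1 in zbinom (\<alpha> j - j + 1) (int i - int j + 1)) =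
      mat n n (\<lambda>(r, s). f r s)"
    using assms(3) by (intro cong_mat) (auto simp only: prod.case intro!: entry)
  ultimately show ?thesis using assms(3) by simp
qed

section \<open>The span of the Schubert variety\<close>

lemma sum_fun_apply: "(\<Sum>x\<in>A. g x) i = (\<Sum>x\<in>A. g x i)"
  for g :: "'a \<Rightarrow> 'b \<Rightarrow> 'c::comm_monoid_add"
  by (induction A rule: infinite_finite_induct) auto

lemma fscale_apply [simp]: "fscale c v i = c * v i"
  by (simp add: fscale_def)

lemma in_span_coordinates:
  fixes v :: "'i \<Rightarrow> 'a::field"
  assumes "finite J" "\<And>i. i \<notin> J \<Longrightarrow> v i = 0"
  shows "v \<in> fvs.span ((\<lambda>j i. if i = j then 1 else 0) ` J)"
proof -
  have "v = (\<Sum>j\<in>J. fscale (v j) (\<lambda>i. if i = j then 1 else 0))"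
    using assms by (auto simp: fun_eq_iff sum_fun_apply if_distrib[of "(*) _"] cong: if_cong)
  also have "\<dots> \<in> fvs.span ((\<lambda>j i. if i = j then 1 else 0) ` J)"
    by (intro fvs.span_sum fvs.span_scale fvs.span_base imageI)
  finally show ?thesis .
qed

lemma dim_supported_le:
  fixes V :: "('i \<Rightarrow> 'a::field) set"
  assumes "finite J" "\<And>v i. v \<in> V \<Longrightarrow> i \<notin> J \<Longrightarrow> v i = 0"
  shows "fvs.dim V \<le> card J"
proof -
  let ?e = "\<lambda>j i. if i = j then 1 else (0::'a)"
  have "fvs.dim V \<le> card (?e ` J)"
    using assms by (intro fvs.dim_le_card) (auto intro!: in_span_coordinates)
  also have "\<dots> \<le> card J" by (rule card_image_le[OF assms(1)])
  finally show ?thesis .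
qed

lemma inj_coordinate: "inj (\<lambda>j i. if i = j then 1 else (0::'a::field))"
  by (rule injI) (metis zero_neq_one)

lemma independent_coordinates:
  assumes "finite J"
  shows "fvs.independent ((\<lambda>j i. if i = j then 1 else (0::'a::field)) ` J)"
proof (rule fvs.independent_if_scalars_zero)
  let ?e = "\<lambda>j i. if i = j then 1 else (0::'a)"
  have inj: "inj_on ?e J" by (rule inj_on_subset[OF inj_coordinate]) simp
  fix g x assume 0: "(\<Sum>x\<in>?e ` J. fscale (g x) x) = 0" and "x \<in> ?e ` J"
  then obtain j where j: "j \<in> J" "x = ?e j" by auto
  have "(\<Sum>j\<in>J. fscale (g (?e j)) (?e j)) j = 0"
    using 0 by (simp add: sum.reindex[OF inj])
  with assms j show "g x = 0"
    by (simp add: sum_fun_apply if_distrib[of "(*) _"] cong: if_cong)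
qed (use assms in simp)

text \<open>Restriction to \<open>J\<close> maps \<open>U\<close> into a space of dimension at most
  \<open>card J\<close>, so it is not injective; subtract two vectors with the same
  restriction.\<close>

lemma exists_vanishing_vector:
  fixes U :: "('i \<Rightarrow> 'a::field) set"
  assumes U: "fvs.subspace U" and J: "finite J" and less: "card J < fvs.dim U"
  obtains w where "w \<in> U" "w \<noteq> 0" "\<And>i. i \<in> J \<Longrightarrow> w i = 0"
proof -
  define T where "T v = (\<lambda>i. if i \<in> J then v i else (0::'a))" for v
  interpret T: vector_space_pair "fscale :: 'a \<Rightarrow> ('i \<Rightarrow> 'a) \<Rightarrow> 'i \<Rightarrow> 'a" "fscale :: 'a \<Rightarrow> ('i \<Rightarrow> 'a) \<Rightarrow> 'i \<Rightarrow> 'a"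
    by unfold_locales
  have lin: "Vector_Spaces.linear fscale fscale T"
    by unfold_locales (auto simp: T_def fun_eq_iff)
  obtain B where B: "B \<subseteq> U" "fvs.independent B" "U \<subseteq> fvs.span B" "card B = fvs.dim U"
    using fvs.basis_exists by blast
  have span: "fvs.span B = U" using B U fvs.span_minimal by blast
  have "\<not> inj_on T U"
  proof
    assume inj: "inj_on T U"
    have "fvs.independent (T ` B)"
      using T.linear_independent_injective_image[OF lin B(2)] inj span by simp
    then have "card (T ` B) = fvs.dim (T ` B)" by (simp add: fvs.dim_eq_card_independent)
    also have "\<dots> \<le> card J" by (rule dim_supported_le[OF J]) (auto simp: T_def)
    finally show False
      using less B(1,4) card_image[OF inj_on_subset[OF inj B(1)]] by simp
  qed
  then obtain x y where xy: "x \<in> U" "y \<in> U" "x \<noteq> y" "T x = T y"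
    by (auto simp: inj_on_def)
  show thesis
  proof
    show "x - y \<in> U" using xy U by (simp add: fvs.subspace_diff)
    show "x - y \<noteq> 0" using xy by simp
    show "(x - y) i = 0" if "i \<in> J" for i
      using fun_cong[OF xy(4), of i] that by (simp add: T_def)
  qed
qed

text \<open>The full function space may be infinite-dimensional, where \<open>dim\<close> defaults
  to 0; the common finite support of \<open>V\<close> guarantees a finite basis.\<close>

lemma dim_mono_supported:
  fixes U V :: "('i \<Rightarrow> 'a::field) set"
  assumes "U \<subseteq> V" "finite J" "\<And>v i. v \<in> V \<Longrightarrow> i \<notin> J \<Longrightarrow> v i = 0"
  shows "fvs.dim U \<le> fvs.dim V"
proof -
  let ?e = "\<lambda>j i. if i = j then 1 else (0::'a)"
  obtain B where B: "B \<subseteq> V" "fvs.independent B" "V \<subseteq> fvs.span B" "card B = fvs.dim V"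
    using fvs.basis_exists by blast
  have "B \<subseteq> fvs.span (?e ` J)" using B(1) assms by (auto intro!: in_span_coordinates)
  then have "finite B" using fvs.independent_span_bound[OF _ B(2)] assms(2) by blast
  then show ?thesis using fvs.dim_le_card[of U B] B(3,4) assms(1) by auto
qed

text \<open>The coefficients of \<open>w\<close> in \<open>ws\<close> form a vector killed by the
  transposed minor matrix in the columns \<open>I\<close>, which is invertible.\<close>

lemma wedge_nonzero_imp_vanishing_vector_zero:
  fixes ws :: "(nat \<Rightarrow> 'a::field) list"
  assumes ws: "distinct ws" "length ws = l" and w: "w \<in> fvs.span (set ws)"
    and nz: "wedge l m ws I \<noteq> 0" and van: "\<And>i. i \<in> I \<Longrightarrow> w i = 0"
  shows "w = 0"
proof -
  let ?M = "mat l l (\<lambda>(r, s). (ws ! r) (sorted_list_of_set I ! s))"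
  have I: "I \<subseteq> {1..m}" "card I = l" and det: "det ?M \<noteq> 0"
    using nz by (auto simp: wedge_def split: if_splits)
  have finI: "finite I" using I(1) finite_subset by auto
  obtain u where u: "w = (\<Sum>v\<in>set ws. fscale (u v) v)"
    using w by (auto simp: fvs.span_finite)
  have sum_ws: "(\<Sum>v\<in>set ws. h v) = (\<Sum>r<l. h (ws ! r))" for h :: "(nat \<Rightarrow> 'a) \<Rightarrow> 'b::comm_monoid_add"
    using ws by (intro sum.reindex_bij_betw[symmetric] bij_betw_nth) auto
  define c where "c = vec l (\<lambda>r. u (ws ! r))"
  have "?M\<^sup>T *\<^sub>v c = 0\<^sub>v l"
  proof (rule eq_vecI)
    fix s assume s: "s < dim_vec (0\<^sub>v l :: 'a vec)"
    then have "sorted_list_of_set I ! s \<in> I"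
      using I finI nth_mem[of s "sorted_list_of_set I"] by simp
    then have "(\<Sum>v\<in>set ws. u v * v (sorted_list_of_set I ! s)) = 0"
      using van u by (simp add: sum_fun_apply)
    then have "(\<Sum>r<l. u (ws ! r) * (ws ! r) (sorted_list_of_set I ! s)) = 0"
      by (simp only: sum_ws)
    then show "(?M\<^sup>T *\<^sub>v c) $ s = 0\<^sub>v l $ s"
      using s by (simp add: c_def scalar_prod_def mult.commute lessThan_atLeast0)
  qed simp
  moreover have "det ?M\<^sup>T \<noteq> 0" using det by (simp add: det_transpose[of _ l])
  moreover have "c \<in> carrier_vec l" by (simp add: c_def)
  ultimately have "c = 0\<^sub>v l"
    using det_0_iff_vec_prod_zero_field[of "?M\<^sup>T" l] by auto
  then have "u (ws ! r) = 0" if "r < l" for r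
    using that by (metis c_def index_vec index_zero_vec(1))
  then show "w = 0" by (simp add: u sum_ws)
qed

section \<open>Pluecker coordinates on the Schubert variety\<close>

definition coord_subspace :: "nat set \<Rightarrow> (nat \<Rightarrow> 'a::field) set" where
  "coord_subspace I = fvs.span (std_basis ` I)"

lemma coord_subspace_supported:
  assumes "v \<in> coord_subspace I" "i \<notin> I"
  shows "v i = 0"
proof -
  have "fvs.subspace {v. v i = 0}" by (auto simp: fvs.subspace_def)
  then have "coord_subspace I \<subseteq> {v. v i = 0}"
    unfolding coord_subspace_def using assms(2) by (intro fvs.span_minimal) (auto simp: std_basis_def)
  with assms(1) show ?thesis by blast
qed

lemma flag_eq_coord_subspace: "flag j = coord_subspace {1..j}"
  by (simp add: flag_def coord_subspace_def)

lemma subspace_flag: "fvs.subspace (flag j)"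
  unfolding flag_def by (rule fvs.subspace_span)

lemma length_ordered_basis:
  assumes "ordered_basis W ws"
  shows "length ws = fvs.dim W"
  using assms fvs.dim_span_eq_card_independent[of "set ws"]
  by (auto simp: ordered_basis_def distinct_card)

lemma wedge_support_schubert:
  fixes W :: "(nat \<Rightarrow> 'a::field) set"
  assumes W: "W \<in> schubert_variety l m \<alpha>" and ws: "ordered_basis W ws"
    and nz: "wedge l m ws I \<noteq> 0"
  shows "I \<in> schubert_index \<alpha> l m"
proof -
  have sub: "fvs.subspace W" and dim: "fvs.dim W = l"
    and inc: "\<And>i. i \<in> {1..l} \<Longrightarrow> i \<le> fvs.dim (W \<inter> flag (\<alpha> i))"
    using W by (auto simp: schubert_variety_def grassmannian_def)
  have I: "I \<subseteq> {1..m}" "card I = l" using nz by (auto simp: wedge_def split: if_splits)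
  have "i \<le> card (I \<inter> {1..\<alpha> i})" if i: "i \<in> {1..l}" for i
  proof (rule ccontr)
    assume "\<not> i \<le> card (I \<inter> {1..\<alpha> i})"
    then have less: "card (I \<inter> {1..\<alpha> i}) < fvs.dim (W \<inter> flag (\<alpha> i))" using inc[OF i] by simp
    obtain w where w: "w \<in> W \<inter> flag (\<alpha> i)" "w \<noteq> 0" and van: "\<And>j. j \<in> I \<inter> {1..\<alpha> i} \<Longrightarrow> w j = 0"
      using exists_vanishing_vector[OF fvs.subspace_inter[OF sub subspace_flag] _ less] by auto
    \<comment> \<open>Up to \<open>\<alpha> i\<close> this is the choice of \<open>w\<close>; beyond
      it, membership in the flag space forces the zero.\<close>
    have "w j = 0" if "j \<in> I" for j
      using w(1) van[of j] that coord_subspace_supported[of w "{1..\<alpha> i}" j]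
      by (auto simp: flag_eq_coord_subspace)
    then have "w = 0"
      using ws w(1) nz length_ordered_basis[OF ws] dim
      by (intro wedge_nonzero_imp_vanishing_vector_zero[of ws l w m I]) (auto simp: ordered_basis_def)
    with w(2) show False by simp
  qed
  with I show ?thesis by (simp add: schubert_index_def)
qed

lemma plucker_vanish:
  assumes "\<And>ws. ordered_basis W ws \<Longrightarrow> wedge l m ws I = 0" and v: "v \<in> plucker l m W"
  shows "v I = 0"
proof -
  have "fvs.subspace {v. v I = 0}" by (auto simp: fvs.subspace_def)
  with v show ?thesis
    unfolding plucker_def by (rule fvs.span_induct) (use assms(1) in auto)
qed

lemma dim_std_basis:
  assumes "finite J"
  shows "fvs.dim (std_basis ` J :: (nat \<Rightarrow> 'a::field) set) = card J"
  using fvs.dim_eq_card_independent[OF independent_coordinates[OF assms, where 'a='a]]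
    card_image[OF inj_on_subset[OF inj_coordinate[where 'a='a]], of J]
  by (simp add: std_basis_def[abs_def])

lemma coord_subspace_in_schubert_variety:
  assumes I: "I \<in> schubert_index \<alpha> l m"
  shows "coord_subspace I \<in> (schubert_variety l m \<alpha> :: (nat \<Rightarrow> 'a::field) set set)"
proof -
  have sub: "I \<subseteq> {1..m}" and card: "card I = l" using I by (auto simp: schubert_index_def)
  have fin: "finite I" using sub finite_subset by auto
  have "i \<le> fvs.dim (coord_subspace I \<inter> flag (\<alpha> i) :: (nat \<Rightarrow> 'a) set)" if "i \<in> {1..l}" for i
  proof -
    have "i \<le> card (I \<inter> {1..\<alpha> i})" using I that by (auto simp: schubert_index_def)
    also have "\<dots> = fvs.dim (std_basis ` (I \<inter> {1..\<alpha> i}) :: (nat \<Rightarrow> 'a) set)"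
      by (simp add: dim_std_basis)
    also have "\<dots> \<le> fvs.dim (coord_subspace I \<inter> flag (\<alpha> i) :: (nat \<Rightarrow> 'a) set)"
      using coord_subspace_supported fin
      by (intro dim_mono_supported[of _ _ I]) (auto simp: coord_subspace_def flag_def intro!: fvs.span_base)
    finally show ?thesis .
  qed
  moreover have "coord_subspace I \<subseteq> (Vsp m :: (nat \<Rightarrow> 'a) set)"
    using coord_subspace_supported sub by (fastforce simp: Vsp_def)
  moreover have "fvs.dim (coord_subspace I :: (nat \<Rightarrow> 'a) set) = l"
    using fin card by (simp add: coord_subspace_def dim_std_basis)
  ultimately show ?thesis
    by (auto simp: schubert_variety_def grassmannian_def coord_subspace_def)
qed

text \<open>A different \<open>J\<close> of the same size misses some \<open>i\<close> in
  \<open>I\<close>. The basis vector at \<open>i\<close> lies in the subspace and vanishes on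
  \<open>J\<close>, so the minor in the columns \<open>J\<close> is zero.\<close>

lemma plucker_coord_subspace:
  fixes v :: "nat set \<Rightarrow> 'a::field"
  assumes card: "card I = l" and fin: "finite I" and v: "v \<in> plucker l m (coord_subspace I)" and J: "J \<noteq> I"
  shows "v J = 0"
proof (rule plucker_vanish[OF _ v], rule ccontr)
  fix ws :: "(nat \<Rightarrow> 'a) list"
  assume ws: "ordered_basis (coord_subspace I) ws" and nz: "wedge l m ws J \<noteq> 0"
  have "J \<subseteq> {1..m}" "card J = l" using nz by (auto simp: wedge_def split: if_splits)
  then have "finite J" "card J = card I" using card finite_subset by auto
  then have "\<not> I \<subseteq> J" using J card_seteq[of J I] by auto
  then obtain i where i: "i \<in> I" "i \<notin> J" by blast
  have "std_basis i \<in> (coord_subspace I :: (nat \<Rightarrow> 'a) set)"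
    using i by (auto simp: coord_subspace_def intro!: fvs.span_base)
  moreover have "length ws = l"
    using length_ordered_basis[OF ws] fin card by (simp add: coord_subspace_def dim_std_basis)
  moreover have "std_basis i j = (0::'a)" if "j \<in> J" for j
    using i that by (auto simp: std_basis_def)
  ultimately have "std_basis i = (0 :: nat \<Rightarrow> 'a)"
    using ws nz by (intro wedge_nonzero_imp_vanishing_vector_zero[of ws l _ m J]) (auto simp: ordered_basis_def)
  then have "std_basis i i = (0 :: 'a)" by simp
  then show False by (simp add: std_basis_def)
qed

lemma dim_representatives:
  fixes \<rho> :: "(nat set \<Rightarrow> 'a::field) set \<Rightarrow> nat set \<Rightarrow> 'a"
  assumes \<rho>: "representatives (schubert_system l m \<alpha>) \<rho>"
  shows "fvs.dim (\<rho> ` schubert_system l m \<alpha>) = card (schubert_index \<alpha> l m)"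
proof -
  let ?S = "schubert_index \<alpha> l m"
  let ?X = "\<rho> ` schubert_system l m \<alpha>"
  let ?e = "\<lambda>J I. if I = J then 1 else (0::'a)"
  have supp: "v I = 0" if v: "v \<in> ?X" and I: "I \<notin> ?S" for v I
  proof -
    obtain W where W: "W \<in> schubert_variety l m \<alpha>" and "v = \<rho> (plucker l m W)"
      using v by (auto simp: schubert_system_def)
    then have "v \<in> plucker l m W" using \<rho> by (auto simp: representatives_def schubert_system_def)
    then show ?thesis using wedge_support_schubert[OF W] I
      by (intro plucker_vanish[where I = I]) blast+
  qed
  have sub: "?e ` ?S \<subseteq> fvs.span ?X"
  proof safe
    fix I assume I: "I \<in> ?S"
    define v where "v = \<rho> (plucker l m (coord_subspace I))"
    have "plucker l m (coord_subspace I) \<in> schubert_system l m \<alpha>"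
      using coord_subspace_in_schubert_variety[OF I] by (auto simp: schubert_system_def)
    then have vX: "v \<in> ?X" and vP: "v \<in> plucker l m (coord_subspace I)" and nz: "v \<noteq> 0"
      using \<rho> by (auto simp: representatives_def v_def)
    have "card I = l" "finite I" using I by (auto simp: schubert_index_def dest: finite_subset)
    from plucker_coord_subspace[OF this vP] have off: "v J = 0" if "J \<noteq> I" for J
      using that by blast
    have "v I \<noteq> 0"
    proof
      assume "v I = 0"
      then have "v = 0" using off by (metis ext zero_fun_apply)
      with nz show False by simp
    qed
    \<comment> \<open>The nonzero representative is supported at \<open>I\<close> alone, so
      rescaling it gives the coordinate vector.\<close>
    then have "?e I = fscale (inverse (v I)) v" using off by (auto simp: fun_eq_iff)
    then show "?e I \<in> fvs.span ?X" using vX by (simp add: fvs.span_scale fvs.span_base)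
  qed
  have "?X \<subseteq> fvs.span (?e ` ?S)"
    using supp by (auto intro!: in_span_coordinates)
  with sub have "fvs.span (?e ` ?S) = fvs.span ?X"
    by (metis fvs.span_mono fvs.span_span subset_antisym)
  then have "fvs.dim ?X = card (?e ` ?S)"
    by (rule fvs.dim_eq_card) (simp add: independent_coordinates)
  also have "\<dots> = card ?S"
    by (rule card_image[OF inj_on_subset[OF inj_coordinate]]) simp
  finally show ?thesis .
qed

lemma finite_Vsp: "finite (Vsp m :: (nat \<Rightarrow> 'a::{finite,field}) set)"
  using finite_set_of_finite_funs[of "{1..m}" "UNIV :: 'a set" 0] by (simp add: Vsp_def)

text \<open>Finiteness of the field enters here: it supplies the finite system that
  \<open>dim_linear_code\<close> asks for.\<close>

lemma finite_schubert_system: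
  "finite (schubert_system l m \<alpha> :: (nat set \<Rightarrow> 'a::{finite,field}) set set)"
proof -
  have "schubert_variety l m \<alpha> \<subseteq> Pow (Vsp m :: (nat \<Rightarrow> 'a) set)"
    by (auto simp: schubert_variety_def grassmannian_def)
  then show ?thesis
    unfolding schubert_system_def using finite_Vsp finite_subset by blast
qed

theorem theorem3p1:
  fixes l m :: nat and \<alpha> :: "nat \<Rightarrow> nat"
    and \<rho> :: "(nat set \<Rightarrow> 'q::{finite,field}) set \<Rightarrow> nat set \<Rightarrow> 'q"
  assumes "1 \<le> l" and "l \<le> m"
    and "strict_mono_on {1..l} \<alpha>"
    and "\<alpha> ` {1..l} \<subseteq> {1..m}"
    and "representatives (schubert_system l m \<alpha>) \<rho>"
  shows "int (fvs.dim (schubert_code l m \<alpha> \<rho>)) =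
    det (mat l l (\<lambda>(r, s). let i = r + 1; j = s + 1
      in zbinom (\<alpha> j - j + 1) (int i - int j + 1)))"
  unfolding schubert_code_def dim_linear_code[OF finite_schubert_system] dim_representatives[OF assms(5)]
  using assms(3,4) by (rule card_schubert_index_eq_det) simp

end
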